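(* Let $$A=\begin{bmatrix} A_{ff} & A_{fc} \\ A_{cf} & A_{cc} \end{bmatrix}\in\mathbb{R}^{n\times n}$$ be symmetric positive definite, where the second block has size $n_c$, and let $$P_\star=\begin{bmatrix} -A_{ff}^{-1}A_{fc} \\ I \end{bmatrix}$$ be the ideal interpolation matrix. For $\tau>0$ define the block factorized smoother with exact $F$-relaxation $$M_{\tau}=\begin{bmatrix} A_{ff} & 0 \\ A_{cf} & \tau I \end{bmatrix}\begin{bmatrix} I & A_{ff}^{-1}A_{fc} \\ 0 & I \end{bmatrix},$$ with $\tau$ sufficiently large that $M_\tau+M_\tau^T-A$ is symmetric positive definite, and let $\widetilde{M}_\tau=M_\tau(M_\tau+M_\tau^T-A)^{-1}M_\tau^T$. Then: (1) The eigenvalues $\lambda_1\le\cdots\le\lambda_n$ of $A\mathbf{x}=\lambda\widetilde{M}_\tau\mathbf{x}$ satisfy $\lambda_{n_c+1}=\cdots=\lambda_n=1$, and the two-grid method with smoother $M_\tau$ and optimal interpolation $(\bar P_\sharp)_\tau$ is an exact solve for every such $\tau$: $\|E_{TG}\|_A=0$. (2) $\displaystyle\lim_{\tau\to\infty}(\bar P_\sharp)_\tau=P_\star$. (3) As $\tau\to\infty$, $$M_\tau^{-1}\to\begin{bmatrix} A_{ff}^{-1} & 0 \\ 0 & 0 \end{bmatrix},\qquad \widetilde{M}_\tau^{-1}A\to\begin{bmatrix} I & A_{ff}^{-1}A_{fc} \\ 0 & 0 \end{bmatrix},$$ and for this limiting case (pure $F$-relaxation) the optimal interpolation, whose columns are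 $n_c$ linearly independent eigenvectors of the last matrix for the eigenvalue $0$, has the same range as the ideal interpolation matrix $P_\star$.
   Context: Here $1\le n_c<n$. For given $\tau$, let $\mathbf{v}_1,\dots,\mathbf{v}_n$ be $\widetilde{M}_\tau$-orthonormal eigenvectors of $A\mathbf{x}=\lambda\widetilde{M}_\tau\mathbf{x}$ belonging to $\lambda_1\le\cdots\le\lambda_n$. The optimal interpolation is $P_\sharp=\begin{pmatrix}\mathbf{v}_1&\cdots&\mathbf{v}_{n_c}\end{pmatrix}=\begin{bmatrix} P_f \\ P_c \end{bmatrix}$ (row blocks conforming to the partition of $A$), and its classical form, defined when the $n_c\times n_c$ block $P_c$ is nonsingular (which is assumed), is $(\bar P_\sharp)_\tau=P_\sharp P_c^{-1}$. The two-grid error propagator with smoother $M$ and full rank interpolation $P$ is $E_{TG}=(I-M^{-1}A)(I-P(P^TAP)^{-1}P^TA)$, and $\|\cdot\|_A$ is the operator norm induced by $\|\mathbf{v}\|_A^2=\mathbf{v}^TA\mathbf{v}$. *)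

theory Defs
  imports "HOL-Analysis.Analysis"
begin

text \<open>The unknowns are indexed by the sum type \<open>'f + 'c\<close> (F-points \<open>Inl\<close>, C-points \<open>Inr\<close>), so
  \<open>n = CARD('f + 'c)\<close>, \<open>n\<^sub>c = CARD('c)\<close>, and \<open>1 \<le> n\<^sub>c < n\<close> holds because types are nonempty.\<close>

definition block_mat ::
  "real^'f^'f \<Rightarrow> real^'c^'f \<Rightarrow> real^'f^'c \<Rightarrow> real^'c^'c
    \<Rightarrow> real^('f::finite + 'c::finite)^('f + 'c)" where
  "block_mat X Y Z W =
    (\<chi> i j. case i of
       Inl a \<Rightarrow> (case j of Inl b \<Rightarrow> X $ a $ b | Inr b \<Rightarrow> Y $ a $ b)
     | Inr a \<Rightarrow> (case j of Inl b \<Rightarrow> Z $ a $ b | Inr b \<Rightarrow> W $ a $ b))"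

definition vstack :: "real^'m^'f \<Rightarrow> real^'m^'c \<Rightarrow> real^'m^('f::finite + 'c::finite)" where
  "vstack X Y = (\<chi> i. case i of Inl a \<Rightarrow> X $ a | Inr a \<Rightarrow> Y $ a)"

definition lower_rows :: "real^'m^('f::finite + 'c::finite) \<Rightarrow> real^'m^'c" where
  "lower_rows P = (\<chi> i. P $ Inr i)"

definition spd :: "real^'n^'n \<Rightarrow> bool" where
  "spd A \<longleftrightarrow> transpose A = A \<and> (\<forall>x. x \<noteq> 0 \<longrightarrow> x \<bullet> (A *v x) > 0)"

definition ideal_interp :: "real^'f^'f \<Rightarrow> real^'c^'f \<Rightarrow> real^'c^('f::finite + 'c::finite)" where
  "ideal_interp Aff Afc = vstack (- (matrix_inv Aff ** Afc)) (mat 1)"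

definition bf_smoother ::
  "real^'f^'f \<Rightarrow> real^'c^'f \<Rightarrow> real^'f^'c \<Rightarrow> real \<Rightarrow> real^('f::finite + 'c::finite)^('f + 'c)" where
  "bf_smoother Aff Afc Acf \<tau> =
    block_mat Aff 0 Acf (\<tau> *\<^sub>R mat 1) ** block_mat (mat 1) (matrix_inv Aff ** Afc) 0 (mat 1)"

definition sym_smoother :: "real^'n^'n \<Rightarrow> real^'n^'n \<Rightarrow> real^'n^'n" where
  "sym_smoother A M = M ** matrix_inv (M + transpose M - A) ** transpose M"

definition admissible :: "real^'n^'n \<Rightarrow> (real \<Rightarrow> real^'n^'n) \<Rightarrow> real \<Rightarrow> bool" where
  "admissible A M \<tau> \<longleftrightarrow> \<tau> > 0 \<and> spd (M \<tau> + transpose (M \<tau>) - A)"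

text \<open>\<open>v 1, \<dots>, v n\<close> are \<open>B\<close>-orthonormal eigenvectors of the pencil \<open>A x = \<lambda> B x\<close> belonging to
  \<open>lam 1 \<le> \<dots> \<le> lam n\<close>; values at indices outside \<open>{1..n}\<close> are irrelevant.\<close>

definition gen_eigensystem ::
  "real^'n^'n \<Rightarrow> real^'n^'n \<Rightarrow> (nat \<Rightarrow> real) \<Rightarrow> (nat \<Rightarrow> real^'n) \<Rightarrow> bool" where
  "gen_eigensystem A B lam v \<longleftrightarrow>
    mono_on {1..CARD('n)} lam \<and>
    (\<forall>i\<in>{1..CARD('n)}. A *v v i = lam i *\<^sub>R (B *v v i)) \<and>
    (\<forall>i\<in>{1..CARD('n)}. \<forall>j\<in>{1..CARD('n)}. v i \<bullet> (B *v v j) = (if i = j then 1 else 0))"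

text \<open>Columns are indexed by the type \<open>'c\<close>; an enumeration \<open>e\<close> of \<open>'c\<close> by \<open>1, \<dots>, n\<^sub>c\<close> tells which
  eigenvector is stored in which column.\<close>

definition optimal_interp :: "('c \<Rightarrow> nat) \<Rightarrow> (nat \<Rightarrow> real^'n) \<Rightarrow> real^'c^'n" where
  "optimal_interp e v = (\<chi> i j. v (e j) $ i)"

definition classical_form :: "real^'c^('f::finite + 'c::finite) \<Rightarrow> real^'c^('f + 'c)" where
  "classical_form P = P ** matrix_inv (lower_rows P)"

definition two_grid_error :: "real^'n^'n \<Rightarrow> real^'n^'n \<Rightarrow> real^'c^'n \<Rightarrow> real^'n^'n" where
  "two_grid_error A M P =
    (mat 1 - matrix_inv M ** A) **
    (mat 1 - P ** matrix_inv (transpose P ** A ** P) ** transpose P ** A)"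

definition energy_norm :: "real^'n^'n \<Rightarrow> real^'n \<Rightarrow> real" where
  "energy_norm A x = sqrt (x \<bullet> (A *v x))"

definition energy_opnorm :: "real^'n^'n \<Rightarrow> real^'n^'n \<Rightarrow> real" where
  "energy_opnorm A E = (SUP x\<in>{x. x \<noteq> 0}. energy_norm A (E *v x) / energy_norm A x)"

definition eigenvector_of :: "real^'n^'n \<Rightarrow> real \<Rightarrow> real^'n \<Rightarrow> bool" where
  "eigenvector_of G \<mu> x \<longleftrightarrow> x \<noteq> 0 \<and> G *v x = \<mu> *\<^sub>R x"

text \<open>Injectivity is needed since \<open>columns P\<close> is a set and so forgets repeated columns.\<close>

definition indep_eigencolumns :: "real^'n^'n \<Rightarrow> real \<Rightarrow> real^'c^'n \<Rightarrow> bool" where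
  "indep_eigencolumns G \<mu> P \<longleftrightarrow>
    (\<forall>j. eigenvector_of G \<mu> (column j P)) \<and>
    inj (\<lambda>j. column j P) \<and> independent (columns P)"

end

theory Submission
  imports Defs
begin

text \<open>
Write \<open>D = A\<^sub>f\<^sub>f\<^sup>-\<^sup>1 A\<^sub>f\<^sub>c\<close> and let \<open>S = A\<^sub>c\<^sub>c - A\<^sub>c\<^sub>f D\<close> be the Schur complement. Multiplying out the factors
of the smoother gives \<open>M\<^sub>\<tau> = A + K\<close>, where \<open>K\<close> has the single nonzero block \<open>\<tau> I - S\<close> in the coarse
corner. So \<open>M\<^sub>\<tau>\<close> is symmetric and has the same F-rows as \<open>A\<close>; everything rests on these two facts.

The eigenproblem is handled through one auxiliary vector. Put \<open>N = M + M\<^sup>T - A\<close> and let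
\<open>N w = M x\<close>, so that the symmetrized smoother maps \<open>x\<close> to \<open>M w\<close>.

\<^item> With \<open>t = x - w\<close> and \<open>x\<close> normalized, \<open>1 - \<lambda> = t \<bullet> N t\<close>. Hence \<open>\<lambda> \<le> 1\<close>, and \<open>\<lambda> = 1\<close> forces
  \<open>M x = A x\<close>: the smoother treats such an \<open>x\<close> exactly (\<open>sym_smoother_eigenvalue\<close>).

\<^item> The F-rows of \<open>M\<close>, \<open>N\<close> and \<open>A\<close> coincide, so the F-rows of \<open>A x = \<lambda> M w\<close> and \<open>N w = M x\<close> say that
  \<open>(A x)\<^sub>f = \<lambda> (A x)\<^sub>f\<close>. If \<open>\<lambda> \<noteq> 1\<close>, then \<open>x\<^sub>f = - D x\<^sub>c\<close>, that is, \<open>x\<close> lies in the range of the ideal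
  interpolation (\<open>eigenvector_in_range_ideal\<close>).

That range has dimension \<open>n\<^sub>c\<close>, so at most \<open>n\<^sub>c\<close> members of an orthonormal eigensystem have
\<open>\<lambda> \<noteq> 1\<close>; since no eigenvalue exceeds 1, the ones after position \<open>n\<^sub>c\<close> equal 1. The two-grid method is
then exact on each eigenvector: the coarse correction removes the first \<open>n\<^sub>c\<close> and leaves the others,
which the smoother removes.

The limit of the classical optimal interpolation is in fact attained. Once \<open>\<tau>\<close> exceeds the norm of
\<open>S\<close>, the block \<open>\<tau> I - S\<close> is positive definite, so \<open>\<lambda> = 1\<close> forces \<open>K x = 0\<close> and \<open>x\<^sub>c = 0\<close>. This leaves
room for only \<open>n\<^sub>f\<close> such eigenvectors, so the first \<open>n\<^sub>c\<close> have \<open>\<lambda> \<noteq> 1\<close> and lie in the range of the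
ideal interpolation \<open>P\<^sub>\<star>\<close>. As the C-block of \<open>P\<^sub>\<star>\<close> is the identity, the classical form then equals
\<open>P\<^sub>\<star>\<close> (\<open>optimal_eq_ideal\<close>).

The matrix limits follow from an explicit inverse that is affine in \<open>1 / \<tau>\<close>, and
the kernel of the limiting matrix is the range of \<open>P\<^sub>\<star>\<close> (\<open>limit_kernel_iff\<close>).
\<close>

section \<open>Inverses and positive definite matrices\<close>

lemma matrix_inv_eqI:
  fixes X :: "real^'n^'n"
  assumes "X ** Y = mat 1"
  shows "matrix_inv X = Y" and "invertible X"
proof -
  have YX: "Y ** X = mat 1"
    using assms matrix_left_right_inverse by blast
  then show "invertible X"
    using assms invertible_def by blast
  have "X ** matrix_inv X = mat 1 \<and> matrix_inv X ** X = mat 1"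
    unfolding matrix_inv_def by (rule someI[of _ Y]) (simp add: assms YX)
  then show "matrix_inv X = Y"
    by (metis YX matrix_mul_assoc matrix_mul_lid matrix_mul_rid)
qed

lemma matrix_inv_mult:
  fixes X :: "real^'n^'n"
  assumes "invertible X"
  shows "X ** matrix_inv X = mat 1" and "matrix_inv X ** X = mat 1"
proof -
  obtain Y where "X ** Y = mat 1" using assms invertible_right_inverse by blast
  then show "X ** matrix_inv X = mat 1" and "matrix_inv X ** X = mat 1"
    using matrix_inv_eqI(1) matrix_left_right_inverse by blast+
qed

lemma transpose_matrix_inv:
  fixes X :: "real^'n^'n"
  assumes "invertible X"
  shows "transpose (matrix_inv X) = matrix_inv (transpose X)"
  using matrix_inv_eqI(1)[of "transpose X" "transpose (matrix_inv X)"] matrix_inv_mult(2)[OF assms]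
  by (metis matrix_transpose_mul transpose_mat)

lemma matrix_mult_zero [simp]:
  fixes X :: "real^'n^'m"
  shows "X ** (0 :: real^'k^'n) = 0" and "(0 :: real^'m^'k) ** X = 0"
  by (simp_all add: matrix_matrix_mult_def vec_eq_iff)

lemma matrix_mult_linear:
  fixes X Y :: "real^'n^'m" and Z W :: "real^'k^'n"
  shows "(X + Y) ** Z = X ** Z + Y ** Z" and "X ** (Z + W) = X ** Z + X ** W"
    and "(X - Y) ** Z = X ** Z - Y ** Z" and "X ** (Z - W) = X ** Z - X ** W"
    and "(- X) ** Z = - (X ** Z)" and "X ** (- Z) = - (X ** Z)"
    and "(c *\<^sub>R X) ** Z = c *\<^sub>R (X ** Z)" and "X ** (c *\<^sub>R Z) = c *\<^sub>R (X ** Z)"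
  by (simp_all add: matrix_matrix_mult_def vec_eq_iff algebra_simps sum.distrib sum_subtractf
      sum_negf sum_distrib_left)

lemma minus_matrix_mult:
  fixes X :: "real^'n^'m"
  shows "(- X) *v y = - (X *v y)"
  by (simp add: matrix_vector_mult_def vec_eq_iff sum_negf)

lemma tendsto_matrix_mult:
  fixes F :: "'z \<Rightarrow> real^'n^'m" and G :: "'z \<Rightarrow> real^'k^'n"
  assumes "(F \<longlongrightarrow> X) net" and "(G \<longlongrightarrow> Y) net"
  shows "((\<lambda>z. F z ** G z) \<longlongrightarrow> X ** Y) net"
  unfolding matrix_matrix_mult_def using assms
  by (intro vec_tendstoI) (auto intro!: tendsto_intros)

lemma dot_transpose_mult:
  fixes X :: "real^'n^'m"
  shows "x \<bullet> (X *v y) = (transpose X *v x) \<bullet> y"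
  by (simp add: dot_lmul_matrix)

lemma dot_symmetric_mult:
  fixes X :: "real^'n^'n"
  assumes "transpose X = X"
  shows "x \<bullet> (X *v y) = y \<bullet> (X *v x)"
  using dot_transpose_mult[of x X y] assms by (simp add: inner_commute)

lemma spd_invertible:
  assumes "spd X" shows "invertible X"
proof -
  have "inj ((*v) X)"
    by (subst vec.inj_iff_eq_0) (use assms in \<open>force simp: spd_def\<close>)+
  then show ?thesis
    using invertible_left_inverse matrix_left_invertible_injective by blast
qed

section \<open>Block matrices and block vectors\<close>

definition f_part :: "real^('f::finite + 'c::finite) \<Rightarrow> real^'f" where
  "f_part x = (\<chi> a. x $ Inl a)"

definition c_part :: "real^('f::finite + 'c::finite) \<Rightarrow> real^'c" where
  "c_part x = (\<chi> a. x $ Inr a)"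

lemma sum_UNIV_Plus:
  fixes g :: "'f::finite + 'c::finite \<Rightarrow> real"
  shows "sum g UNIV = (\<Sum>a\<in>UNIV. g (Inl a)) + (\<Sum>a\<in>UNIV. g (Inr a))"
  by (subst UNIV_Plus_UNIV[symmetric], subst sum.Plus) auto

lemma vec_eq_parts:
  "x = y \<longleftrightarrow> f_part x = f_part y \<and> c_part x = c_part y"
proof -
  have "(\<forall>i. x $ i = y $ i) \<longleftrightarrow> (\<forall>a. x $ Inl a = y $ Inl a) \<and> (\<forall>a. x $ Inr a = y $ Inr a)"
    by (metis old.sum.exhaust)
  then show ?thesis by (simp add: vec_eq_iff f_part_def c_part_def)
qed

lemma inner_parts: "x \<bullet> y = f_part x \<bullet> f_part y + c_part x \<bullet> c_part y"
  by (simp add: inner_vec_def sum_UNIV_Plus f_part_def c_part_def)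

lemma parts_block_mat_mult:
  "f_part (block_mat X Y Z W *v x) = X *v f_part x + Y *v c_part x"
  "c_part (block_mat X Y Z W *v x) = Z *v f_part x + W *v c_part x"
  by (simp_all add: f_part_def c_part_def block_mat_def matrix_vector_mult_def sum_UNIV_Plus
      vec_eq_iff)

lemma parts_vstack_mult:
  "f_part (vstack X Y *v x) = X *v x"  "c_part (vstack X Y *v x) = Y *v x"
  by (simp_all add: f_part_def c_part_def vstack_def matrix_vector_mult_def vec_eq_iff)

lemma c_part_mult: "c_part (P *v x) = lower_rows P *v x"
  by (simp add: c_part_def lower_rows_def matrix_vector_mult_def vec_eq_iff)

lemma lower_rows_mult: "lower_rows (P ** X) = lower_rows P ** X"
  by (simp add: lower_rows_def matrix_matrix_mult_def vec_eq_iff)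

lemma parts_linear:
  "f_part (x + y) = f_part x + f_part y"  "c_part (x + y) = c_part x + c_part y"
  "f_part (c *\<^sub>R x) = c *\<^sub>R f_part x"  "c_part (c *\<^sub>R x) = c *\<^sub>R c_part x"
  "f_part 0 = 0"  "c_part 0 = 0"
  by (simp_all add: f_part_def c_part_def vec_eq_iff)

lemma parts_surj: "\<exists>x. f_part x = y \<and> c_part x = z"
  by (rule exI[of _ "\<chi> i. case i of Inl a \<Rightarrow> y $ a | Inr a \<Rightarrow> z $ a"])
    (simp add: f_part_def c_part_def)

lemma block_mat_mult:
  fixes X :: "real^'f::finite^'f" and W :: "real^'c::finite^'c"
  shows "block_mat X Y Z W ** block_mat X' Y' Z' W' =
    block_mat (X ** X' + Y ** Z') (X ** Y' + Y ** W') (Z ** X' + W ** Z') (Z ** Y' + W ** W')"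
  by (simp add: matrix_eq vec_eq_parts parts_block_mat_mult flip: matrix_vector_mul_assoc)
    (simp add: algebra_simps matrix_vector_mul_assoc)

lemma block_mat_linear:
  "block_mat X Y Z W + block_mat X' Y' Z' W' = block_mat (X + X') (Y + Y') (Z + Z') (W + W')"
  "block_mat X Y Z W - block_mat X' Y' Z' W' = block_mat (X - X') (Y - Y') (Z - Z') (W - W')"
  "c *\<^sub>R block_mat X Y Z W = block_mat (c *\<^sub>R X) (c *\<^sub>R Y) (c *\<^sub>R Z) (c *\<^sub>R W)"
  by (simp_all add: block_mat_def vec_eq_iff split: sum.splits)

lemma block_mat_one: "block_mat (mat 1) 0 0 (mat 1) = mat 1"
  by (simp add: block_mat_def vec_eq_iff mat_def split: sum.splits)

lemma transpose_block_mat: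
  "transpose (block_mat X Y Z W) =
    block_mat (transpose X) (transpose Z) (transpose Y) (transpose W)"
  by (simp add: block_mat_def vec_eq_iff transpose_def split: sum.splits)

lemma block_mat_inject:
  fixes X X' :: "real^'f::finite^'f" and W W' :: "real^'c::finite^'c"
  assumes "block_mat X Y Z W = block_mat X' Y' Z' W'"
  shows "X = X'" "Y = Y'" "Z = Z'" "W = W'"
proof -
  have *: "block_mat X Y Z W $ i $ j = block_mat X' Y' Z' W' $ i $ j" for i j
    using assms by simp
  show "X = X'" "Y = Y'" "Z = Z'" "W = W'"
    using *[of "Inl _" "Inl _"] *[of "Inl _" "Inr _"] *[of "Inr _" "Inl _"] *[of "Inr _" "Inr _"]
    by (simp_all add: vec_eq_iff block_mat_def)
qed

section \<open>Counting orthonormal families\<close>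

text \<open>Pairing a vanishing combination with \<open>B v j\<close> isolates its \<open>j\<close>-th coefficient.\<close>

lemma biorthonormal_independent:
  fixes v :: "nat \<Rightarrow> real^'n"
  assumes "finite I" and orth: "\<And>i j. i \<in> I \<Longrightarrow> j \<in> I \<Longrightarrow> v i \<bullet> (B *v v j) = (if i = j then 1 else 0)"
  shows "inj_on v I" and "independent (v ` I)"
proof -
  show inj: "inj_on v I"
    by (rule inj_onI) (metis orth zero_neq_one)
  show "independent (v ` I)"
  proof (rule independent_if_scalars_zero)
    show "finite (v ` I)" using assms by simp
    fix f x assume s: "(\<Sum>x\<in>v ` I. f x *\<^sub>R x) = 0" and "x \<in> v ` I"
    then obtain j where j: "j \<in> I" "x = v j" by blast
    have "(\<Sum>i\<in>I. f (v i) *\<^sub>R v i) = 0" using s inj by (simp add: sum.reindex)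
    then have "(\<Sum>i\<in>I. f (v i) *\<^sub>R v i) \<bullet> (B *v v j) = 0" by simp
    then have "(\<Sum>i\<in>I. f (v i) * (if i = j then 1 else 0)) = 0"
      using orth j by (simp add: inner_sum_left)
    then show "f x = 0" using j assms(1) by (simp add: if_distrib cong: if_cong)
  qed
qed

lemma card_independent_in_range_le:
  fixes P :: "real^'k^'n"
  assumes "independent V" and "V \<subseteq> range ((*v) P)"
  shows "card V \<le> CARD('k)"
proof -
  have "card V \<le> dim (range ((*v) P))"
    using assms independent_card_le_dim by blast
  also have "\<dots> \<le> dim (UNIV :: (real^'k) set)"
    by (rule dim_image_le) simp
  finally show ?thesis by simp
qed

section \<open>The generalized eigenproblem of a symmetric smoother\<close>

text \<open>The vector \<open>w\<close> allows arguing about the symmetrized smoother without its inner inverse: only the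
linear equation that \<open>w\<close> solves is ever used.\<close>

lemma sym_smoother_mult:
  fixes A M :: "real^'n^'n"
  assumes M: "transpose M = M" and N: "spd (M + transpose M - A)"
  obtains w where "(M + transpose M - A) *v w = M *v x" and "sym_smoother A M *v x = M *v w"
proof -
  let ?N = "M + transpose M - A"
  let ?w = "matrix_inv ?N *v (M *v x)"
  have "?N *v ?w = M *v x"
    using matrix_inv_mult(1)[OF spd_invertible[OF N]]
    by (simp add: matrix_vector_mul_assoc matrix_mul_assoc)
  moreover have "sym_smoother A M *v x = M *v ?w"
    unfolding sym_smoother_def M by (simp flip: matrix_vector_mul_assoc)
  ultimately show thesis by (rule that)
qed

text \<open>For symmetric \<open>M\<close> the symmetrized smoother minus \<open>A\<close> equals \<open>(M - A) N\<^sup>-\<^sup>1 (M - A)\<close> with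
\<open>N = M + M\<^sup>T - A\<close>, which is positive semidefinite with the kernel of \<open>M - A\<close>. In the proof,
\<open>t = N\<^sup>-\<^sup>1 (M - A) x\<close>.\<close>

lemma sym_smoother_eigenvalue:
  fixes A M :: "real^'n^'n"
  assumes A: "spd A" and M: "transpose M = M" and N: "spd (M + transpose M - A)"
    and ev: "A *v x = lam *\<^sub>R (sym_smoother A M *v x)"
    and nrm: "x \<bullet> (sym_smoother A M *v x) = 1"
  shows "lam \<le> 1" and "lam = 1 \<Longrightarrow> M *v x = A *v x"
proof -
  let ?N = "M + transpose M - A"
  obtain w where Nw: "?N *v w = M *v x" and Mw: "sym_smoother A M *v x = M *v w"
    by (rule sym_smoother_mult[OF M N])
  have N_mult: "?N *v y = M *v y + (M *v y - A *v y)" for y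
    by (simp only: M matrix_vector_mult_diff_rdistrib matrix_vector_mult_add_rdistrib add_diff_eq)
  define t where "t = x - w"
  have Nt: "?N *v t = M *v x - A *v x"
    unfolding t_def matrix_vector_mult_diff_distrib Nw unfolding N_mult by simp
  have "M *v w - A *v x = ?N *v t - M *v t"
    unfolding Nt by (simp add: t_def matrix_vector_mult_diff_distrib)
  also have "\<dots> = M *v t - A *v t"
    unfolding N_mult by simp
  finally have d: "M *v w - A *v x = M *v t - A *v t" .
  have AT: "transpose A = A" using A by (simp add: spd_def)
  have "1 - lam = x \<bullet> (M *v w - A *v x)"
    using nrm unfolding ev Mw by (simp add: inner_diff_right)
  also have "\<dots> = t \<bullet> (?N *v t)"
    unfolding d Nt inner_diff_right
    by (simp add: dot_symmetric_mult[OF M, of x] dot_symmetric_mult[OF AT, of x])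
  finally have l: "1 - lam = t \<bullet> (?N *v t)" .
  have pos: "t \<noteq> 0 \<Longrightarrow> t \<bullet> (?N *v t) > 0" using N by (auto simp: spd_def)
  show "lam \<le> 1" using l pos by (cases "t = 0") auto
  assume "lam = 1"
  then have "t = 0" using l pos by fastforce
  then show "M *v x = A *v x" using Nt by simp
qed

lemma gen_eigensystem_span:
  fixes A B :: "real^'n^'n"
  assumes "gen_eigensystem A B lam v"
  shows "span (v ` {1..CARD('n)}) = UNIV"
proof -
  have b: "inj_on v {1..CARD('n)}" "independent (v ` {1..CARD('n)})"
    by (rule biorthonormal_independent[where B = B]; use assms in \<open>simp add: gen_eigensystem_def\<close>)+
  then have "card (v ` {1..CARD('n)}) = dim (UNIV :: (real^'n) set)"
    by (simp add: card_image)
  then show ?thesis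
    using b(2) card_ge_dim_independent[of "v ` {1..CARD('n)}" UNIV] by auto
qed

text \<open>The dimension count behind both statements on the position of the eigenvalue 1.\<close>

lemma gen_eigensystem_card_le:
  fixes A B :: "real^'n^'n" and P :: "real^'k^'n"
  assumes "gen_eigensystem A B lam v" and "I \<subseteq> {1..CARD('n)}"
    and "\<And>i. i \<in> I \<Longrightarrow> v i \<in> range ((*v) P)"
  shows "card I \<le> CARD('k)"
proof -
  have b: "inj_on v I" "independent (v ` I)"
    by (rule biorthonormal_independent[where B = B];
        use assms(1,2) in \<open>auto simp: gen_eigensystem_def subset_iff finite_subset[OF assms(2)]\<close>)+
  moreover have "card (v ` I) \<le> CARD('k)"
    using b(2) assms(3) by (intro card_independent_in_range_le) auto
  ultimately show ?thesis by (simp add: card_image)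
qed

section \<open>Coarse-grid correction\<close>

lemma energy_opnorm_zero: "energy_opnorm A (0 :: real^'n^'n) = 0"
proof -
  have "{x :: real^'n. x \<noteq> 0} \<noteq> {}"
    using axis_eq_0_iff[of undefined "1 :: real"] by auto
  then show ?thesis by (simp add: energy_opnorm_def energy_norm_def)
qed

text \<open>The coarse-grid correction is the identity minus the \<open>A\<close>-orthogonal projection onto the range of
\<open>X\<close>; positive definiteness of \<open>A\<close> makes the Galerkin matrix \<open>X\<^sup>T A X\<close> invertible.\<close>

lemma galerkin_projection_fixes:
  fixes A :: "real^'n^'n" and X :: "real^'k^'n"
  assumes "spd A" and inj: "\<And>y. X *v y = 0 \<Longrightarrow> y = 0"
  shows "X ** matrix_inv (transpose X ** A ** X) ** transpose X ** A ** X = X"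
proof -
  let ?C = "transpose X ** A ** X"
  have "inj ((*v) ?C)"
  proof (subst vec.inj_iff_eq_0; clarify)
    fix y assume "?C *v y = 0"
    then have "y \<bullet> (transpose X *v (A *v (X *v y))) = 0"
      by (simp only: matrix_vector_mul_assoc matrix_mul_assoc) simp
    then have "(X *v y) \<bullet> (A *v (X *v y)) = 0"
      by (simp only: dot_transpose_mult[of y "transpose X"] transpose_transpose)
    then have "X *v y = 0" using assms(1) unfolding spd_def by force
    then show "y = 0" by (rule inj)
  qed
  then have "invertible ?C"
    using invertible_left_inverse matrix_left_invertible_injective by blast
  then have "matrix_inv ?C ** ?C = mat 1" by (rule matrix_inv_mult)
  then show ?thesis
    by (metis matrix_mul_assoc matrix_mul_rid)
qed

lemma optimal_interp_mult_axis: "optimal_interp e v *v axis j 1 = v (e j)"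
  by (simp add: matrix_vector_mult_basis optimal_interp_def column_def)

lemma transpose_optimal_interp_mult: "(transpose (optimal_interp e v) *v y) $ j = v (e j) \<bullet> y"
  by (simp add: optimal_interp_def transpose_def matrix_vector_mult_def inner_vec_def
      del: transpose_matrix_vector)

lemma classical_form_mult:
  assumes "invertible (lower_rows P)"
  shows "classical_form P ** lower_rows P = P" and "lower_rows (classical_form P) = mat 1"
  using matrix_inv_mult[OF assms]
  by (simp_all add: classical_form_def lower_rows_mult flip: matrix_mul_assoc)

text \<open>The eigenvectors span the space, so the error propagator needs to be evaluated on them only. The
projection fixes the interpolated eigenvectors; it annihilates the others, because orthonormality
of the eigensystem makes them \<open>A\<close>-orthogonal to the coarse space, and the smoother then removes
them since \<open>M\<^sup>-\<^sup>1 A v = v\<close>.\<close>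

lemma two_grid_exact:
  fixes A M :: "real^('f::finite + 'c::finite)^('f + 'c)" and e :: "'c \<Rightarrow> nat"
  assumes A: "spd A" and M: "invertible M"
    and es: "gen_eigensystem A B lam v"
    and e: "bij_betw e UNIV {1..CARD('c)}"
    and inv: "invertible (lower_rows (optimal_interp e v))"
    and fine: "\<And>i. i \<in> {CARD('c) + 1..CARD('f + 'c)} \<Longrightarrow> M *v v i = A *v v i"
  shows "two_grid_error A M (classical_form (optimal_interp e v)) = 0"
proof -
  define P where "P = optimal_interp e v"
  define X where "X = classical_form P"
  define Q where "Q = X ** matrix_inv (transpose X ** A ** X) ** transpose X ** A"
  let ?E = "two_grid_error A M X"
  have XC: "X ** lower_rows P = P" and X1: "lower_rows X = mat 1"
    using classical_form_mult[OF inv] by (simp_all add: X_def P_def)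
  have "Q ** X = X"
    unfolding Q_def
  proof (rule galerkin_projection_fixes[OF A])
    fix y assume "X *v y = 0"
    then have "c_part (X *v y) = 0" by (simp add: parts_linear)
    then show "y = 0" by (simp add: c_part_mult X1)
  qed
  then have QP: "Q ** P = P" by (metis XC matrix_mul_assoc)
  have E: "?E *v y = (mat 1 - matrix_inv M ** A) *v (y - Q *v y)" for y
    by (simp add: two_grid_error_def Q_def matrix_vector_mult_diff_rdistrib flip: matrix_vector_mul_assoc)
  have "?E *v v i = 0" if i: "i \<in> {1..CARD('f + 'c)}" for i
  proof (cases "i \<le> CARD('c)")
    case True
    then obtain j where "i = e j" using e i by (auto simp: bij_betw_def) (metis atLeastAtMost_iff imageE)
    then have "v i = P *v axis j 1" by (simp add: P_def optimal_interp_mult_axis)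
    then have "Q *v v i = v i" by (simp add: matrix_vector_mul_assoc QP)
    then show ?thesis by (simp add: E)
  next
    case False
    have "v (e j) \<bullet> (A *v v i) = 0" for j
    proof -
      have "e j \<in> {1..CARD('c)}" using e by (auto simp: bij_betw_def)
      then have "e j \<noteq> i" "e j \<in> {1..CARD('f + 'c)}" using False i by auto
      then show ?thesis using es i by (simp add: gen_eigensystem_def)
    qed
    then have "transpose P *v (A *v v i) = 0"
      by (simp add: vec_eq_iff P_def transpose_optimal_interp_mult del: transpose_matrix_vector)
    moreover have "transpose X = transpose (matrix_inv (lower_rows P)) ** transpose P"
      by (simp add: X_def classical_form_def matrix_transpose_mul)
    ultimately have "transpose X *v (A *v v i) = 0"
      by (simp add: del: transpose_matrix_vector flip: matrix_vector_mul_assoc)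
    then have "Q *v v i = 0"
      by (simp add: Q_def del: transpose_matrix_vector flip: matrix_vector_mul_assoc)
    moreover have "matrix_inv M *v (A *v v i) = v i"
      using fine[of i] i False matrix_inv_mult(2)[OF M]
      by (metis Suc_eq_plus1 atLeastAtMost_iff matrix_vector_mul_assoc matrix_vector_mul_lid not_less_eq_eq)
    ultimately show ?thesis
      by (simp add: E matrix_vector_mult_diff_rdistrib flip: matrix_vector_mul_assoc)
  qed
  then have "?E *v y = 0" for y
    using linear_eq_0_on_span[of "(*v) ?E" "v ` {1..CARD('f + 'c)}" y]
    unfolding gen_eigensystem_span[OF es] by blast
  then show ?thesis unfolding X_def P_def by (simp add: matrix_eq)
qed

section \<open>The block factorized smoother\<close>

locale spd_block =
  fixes Aff :: "real^'f::finite^'f" and Afc :: "real^'c::finite^'f"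
    and Acf :: "real^'f^'c" and Acc :: "real^'c^'c"
  assumes spd_A: "spd (block_mat Aff Afc Acf Acc)"
begin

abbreviation A where "A \<equiv> block_mat Aff Afc Acf Acc"
abbreviation M where "M \<equiv> bf_smoother Aff Afc Acf"
abbreviation P_ideal where "P_ideal \<equiv> ideal_interp Aff Afc"

definition D where "D = matrix_inv Aff ** Afc"

definition schur where "schur = Acc - Acf ** D"

lemma blocks_symmetric:
  "transpose Aff = Aff" "transpose Afc = Acf" "transpose Acf = Afc" "transpose Acc = Acc"
proof -
  have "block_mat (transpose Aff) (transpose Acf) (transpose Afc) (transpose Acc) = A"
    using spd_A by (simp add: spd_def transpose_block_mat)
  then show "transpose Aff = Aff" "transpose Afc = Acf" "transpose Acf = Afc" "transpose Acc = Acc"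
    by (rule block_mat_inject)+
qed

lemma spd_Aff: "spd Aff"
  unfolding spd_def
proof (intro conjI allI impI)
  show "transpose Aff = Aff" by (rule blocks_symmetric)
  fix y :: "real^'f" assume "y \<noteq> 0"
  obtain x :: "real^('f + 'c)" where x: "f_part x = y" "c_part x = 0"
    using parts_surj by blast
  with \<open>y \<noteq> 0\<close> have "x \<noteq> 0" by (auto simp: parts_linear)
  then have "x \<bullet> (A *v x) > 0" using spd_A by (simp add: spd_def)
  then show "y \<bullet> (Aff *v y) > 0" by (simp add: inner_parts parts_block_mat_mult x)
qed

lemmas Aff_inv = matrix_inv_mult[OF spd_invertible[OF spd_Aff]]

lemma Aff_D: "Aff ** D = Afc"
  by (simp add: D_def matrix_mul_assoc Aff_inv)

lemma smoother_blocks: "M \<tau> = block_mat Aff Afc Acf (Acf ** D + \<tau> *\<^sub>R mat 1)"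
  by (simp add: bf_smoother_def block_mat_mult Aff_D flip: D_def)

lemma smoother_eq: "M \<tau> = A + block_mat 0 0 0 (\<tau> *\<^sub>R mat 1 - schur)"
  by (simp add: smoother_blocks block_mat_linear schur_def)
    (metis add.commute)

lemma smoother_symmetric: "transpose (M \<tau>) = M \<tau>"
proof -
  have "transpose (Acf ** D) = Acf ** D"
    by (simp add: D_def matrix_transpose_mul blocks_symmetric matrix_mul_assoc
        transpose_matrix_inv[OF spd_invertible[OF spd_Aff]])
  then have "transpose (Acf ** D + \<tau> *\<^sub>R mat 1) = Acf ** D + \<tau> *\<^sub>R mat 1"
    by (simp add: vec_eq_iff transpose_def mat_def)
  then show ?thesis by (simp add: smoother_blocks transpose_block_mat blocks_symmetric)
qed

text \<open>Inverting the two triangular factors separately and multiplying gives this formula, in which only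
the second summand depends on \<open>\<tau>\<close>.\<close>

lemma smoother_inverse:
  assumes "\<tau> \<noteq> 0"
  shows "matrix_inv (M \<tau>) =
      block_mat (matrix_inv Aff) 0 0 0 + (1 / \<tau>) *\<^sub>R
        block_mat (D ** Acf ** matrix_inv Aff) (- D) (- (Acf ** matrix_inv Aff)) (mat 1)" (is "_ = ?Y")
    and "invertible (M \<tau>)"
proof -
  have "M \<tau> ** ?Y = mat 1"
    unfolding smoother_blocks block_mat_linear block_mat_mult
    using assms
    by (simp add: matrix_mult_linear matrix_mul_assoc Aff_D Aff_inv block_mat_one scaleR_add_right)
  then show "matrix_inv (M \<tau>) = ?Y" "invertible (M \<tau>)"
    by (rule matrix_inv_eqI)+
qed

text \<open>The equation says that the F-rows of \<open>A x\<close> vanish, multiplied by \<open>A\<^sub>f\<^sub>f\<^sup>-\<^sup>1\<close>.\<close>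

lemma range_ideal_iff: "x \<in> range ((*v) P_ideal) \<longleftrightarrow> f_part x + D *v c_part x = 0"
proof
  assume "x \<in> range ((*v) P_ideal)"
  then show "f_part x + D *v c_part x = 0"
    by (auto simp: ideal_interp_def parts_vstack_mult minus_matrix_mult D_def)
next
  assume "f_part x + D *v c_part x = 0"
  then have "x = P_ideal *v c_part x"
    by (simp add: vec_eq_parts ideal_interp_def parts_vstack_mult D_def[symmetric]
        minus_matrix_mult eq_neg_iff_add_eq_0)
  then show "x \<in> range ((*v) P_ideal)" by blast
qed

lemma c_part_ideal: "c_part (P_ideal *v y) = y"
  by (simp add: ideal_interp_def parts_vstack_mult)

text \<open>Because the C-rows of the ideal interpolation form the identity, a vector in its range is determined
by its C-part, and the coordinates of the columns are read off as \<open>lower_rows P\<close>.\<close>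

lemma eq_ideal_mult:
  assumes "\<And>j. column j P \<in> range ((*v) P_ideal)"
  shows "P = P_ideal ** lower_rows P"
proof -
  have "column j P = P_ideal *v c_part (column j P)" for j
    using assms[of j] by (auto simp: c_part_ideal)
  then have "P *v axis j 1 = (P_ideal ** lower_rows P) *v axis j 1" for j
    by (metis c_part_mult matrix_vector_mul_assoc matrix_vector_mult_basis)
  then have "column j P = column j (P_ideal ** lower_rows P)" for j
    by (simp add: matrix_vector_mult_basis)
  then show ?thesis
    by (simp add: vec_eq_iff column_def)
qed

text \<open>Only the F-rows matter, and on these \<open>M\<close>, \<open>N = M + M\<^sup>T - A\<close> and \<open>A\<close> agree. With \<open>N w = M x\<close> and
\<open>A x = \<lambda> M w\<close>, the F-parts of \<open>A w\<close> and \<open>A x\<close> coincide while that of \<open>A x\<close> is \<open>\<lambda>\<close> times that of \<open>A w\<close>.\<close>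

lemma eigenvector_in_range_ideal:
  assumes adm: "admissible A M \<tau>"
    and ev: "A *v x = lam *\<^sub>R (sym_smoother A (M \<tau>) *v x)" and "lam \<noteq> 1"
  shows "x \<in> range ((*v) P_ideal)"
proof -
  have F: "f_part ((M \<tau> + transpose (M \<tau>) - A) *v y) = f_part (A *v y)"
    "f_part (M \<tau> *v y) = f_part (A *v y)" for y
    by (simp_all only: smoother_symmetric) (simp_all add: smoother_blocks block_mat_linear
      parts_block_mat_mult)
  obtain w where w: "(M \<tau> + transpose (M \<tau>) - A) *v w = M \<tau> *v x"
      "sym_smoother A (M \<tau>) *v x = M \<tau> *v w"
    using sym_smoother_mult[OF smoother_symmetric, of \<tau> A x] adm by (auto simp: admissible_def)
  have "f_part (A *v w) = f_part (A *v x)" using w(1) F by metis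
  moreover have "f_part (A *v x) = lam *\<^sub>R f_part (A *v w)"
    using ev w(2) F by (metis parts_linear(3))
  ultimately have "f_part (A *v x) = 0"
    using \<open>lam \<noteq> 1\<close> by (metis scaleR_cancel_right scaleR_one)
  then have "matrix_inv Aff *v (Aff *v f_part x + Afc *v c_part x) = 0"
    by (simp add: parts_block_mat_mult)
  then show ?thesis
    by (simp add: range_ideal_iff matrix_vector_right_distrib matrix_vector_mul_assoc Aff_inv D_def)
qed

text \<open>Any bound on the spectrum of the Schur complement would serve as a threshold; the maximum with 0 makes
every larger \<open>\<tau>\<close> positive, as admissibility demands.\<close>

definition tau0 where "tau0 = max 0 (onorm ((*v) schur))"

lemma schur_shift_bound:
  "(\<tau> - tau0) * (norm y)\<^sup>2 \<le> y \<bullet> ((\<tau> *\<^sub>R mat 1 - schur) *v y)"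
proof -
  have "y \<bullet> (schur *v y) \<le> norm y * norm (schur *v y)"
    by (rule norm_cauchy_schwarz)
  also have "norm (schur *v y) \<le> onorm ((*v) schur) * norm y"
    by (rule onorm) (rule matrix_vector_mul_bounded_linear)
  also have "\<dots> \<le> tau0 * norm y"
    by (simp add: tau0_def mult_right_mono)
  finally have "y \<bullet> (schur *v y) \<le> norm y * (tau0 * norm y)"
    by (simp add: mult_left_mono)
  then have "y \<bullet> (schur *v y) \<le> tau0 * (norm y)\<^sup>2"
    by (simp add: power2_eq_square mult_ac)
  then show ?thesis
    by (simp add: matrix_vector_mult_diff_rdistrib scaleR_matrix_vector_assoc[symmetric]
        inner_diff_right power2_norm_eq_inner algebra_simps)
qed

lemma admissible_large:
  assumes "\<tau> > tau0" shows "admissible A M \<tau>"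
proof -
  have AT: "transpose A = A" using spd_A by (simp add: spd_def)
  have "0 < x \<bullet> ((M \<tau> + M \<tau> - A) *v x)" if "x \<noteq> 0" for x
  proof -
    have "0 \<le> (\<tau> - tau0) * (norm (c_part x))\<^sup>2" using assms by simp
    also note schur_shift_bound
    finally have "0 \<le> x \<bullet> (block_mat 0 0 0 (\<tau> *\<^sub>R mat 1 - schur) *v x)"
      by (simp add: inner_parts parts_block_mat_mult)
    moreover have "0 < x \<bullet> (A *v x)" using that spd_A by (simp add: spd_def)
    ultimately show ?thesis
      unfolding smoother_eq
      by (simp only: matrix_vector_mult_diff_rdistrib matrix_vector_mult_add_rdistrib
          inner_add_right inner_diff_right)
  qed
  moreover have "transpose (M \<tau> + M \<tau> - A) = M \<tau> + M \<tau> - A"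
    using smoother_symmetric[of \<tau>] AT by (simp add: vec_eq_iff transpose_def)
  moreover have "\<tau> > 0" using assms by (simp add: tau0_def)
  ultimately show ?thesis
    unfolding admissible_def spd_def smoother_symmetric by blast
qed

text \<open>The range of the matrix with blocks \<open>I\<close> and \<open>0\<close> is the space of vectors with vanishing C-part, in a
form to which the dimension count applies.\<close>

lemma smoother_agrees_large:
  assumes "\<tau> > tau0" and "M \<tau> *v x = A *v x"
  shows "x \<in> range ((*v) (vstack (mat 1) 0 :: real^'f^('f + 'c)))"
proof -
  have "block_mat 0 0 0 (\<tau> *\<^sub>R mat 1 - schur) *v x = 0"
    using assms(2) by (simp add: smoother_eq matrix_vector_mult_add_rdistrib)
  then have "c_part (block_mat 0 0 0 (\<tau> *\<^sub>R mat 1 - schur) *v x) = 0"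
    by (simp add: parts_linear)
  then have "(\<tau> *\<^sub>R mat 1 - schur) *v c_part x = 0" by (simp add: parts_block_mat_mult)
  then have "(\<tau> - tau0) * (norm (c_part x))\<^sup>2 \<le> 0"
    using schur_shift_bound[of \<tau> "c_part x"] by simp
  then have "c_part x = 0" using assms(1) by (auto simp: mult_le_0_iff)
  then have "x = vstack (mat 1) 0 *v f_part x" by (simp add: vec_eq_parts parts_vstack_mult)
  then show ?thesis by blast
qed

context
  fixes \<tau> :: real and lam :: "nat \<Rightarrow> real" and v :: "nat \<Rightarrow> real^('f + 'c)"
  assumes adm: "admissible A M \<tau>"
    and es: "gen_eigensystem A (sym_smoother A (M \<tau>)) lam v"
begin

lemma eigenpair:
  assumes "i \<in> {1..CARD('f + 'c)}"
  shows "A *v v i = lam i *\<^sub>R (sym_smoother A (M \<tau>) *v v i)" and "lam i \<le> 1"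
    and "lam i = 1 \<Longrightarrow> M \<tau> *v v i = A *v v i"
proof -
  have N: "spd (M \<tau> + transpose (M \<tau>) - A)" using adm by (simp add: admissible_def)
  show ev: "A *v v i = lam i *\<^sub>R (sym_smoother A (M \<tau>) *v v i)"
    using es assms by (simp add: gen_eigensystem_def)
  have nrm: "v i \<bullet> (sym_smoother A (M \<tau>) *v v i) = 1"
    using es assms by (simp add: gen_eigensystem_def)
  show "lam i \<le> 1" "lam i = 1 \<Longrightarrow> M \<tau> *v v i = A *v v i"
    by (fact sym_smoother_eigenvalue[OF spd_A smoother_symmetric N ev nrm])+
qed

lemma eigenvalue_fine:
  assumes i: "i \<in> {CARD('c) + 1..CARD('f + 'c)}"
  shows "lam i = 1"
proof (rule ccontr)
  assume "lam i \<noteq> 1"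
  \<comment> \<open>By monotonicity, all of the first \<open>i\<close> eigenvalues are then below 1, too many for the range of
    the ideal interpolation.\<close>
  have "card {1..i} \<le> CARD('c)"
  proof (rule gen_eigensystem_card_le[OF es])
    show "{1..i} \<subseteq> {1..CARD('f + 'c)}" using i by auto
    fix j assume j: "j \<in> {1..i}"
    then have "lam j \<le> lam i"
      using es i by (auto simp: gen_eigensystem_def intro: mono_onD)
    moreover have "lam i \<le> 1" using eigenpair(2) i by auto
    ultimately have "lam j \<noteq> 1" using \<open>lam i \<noteq> 1\<close> by linarith
    moreover have "j \<in> {1..CARD('f + 'c)}" using i j by auto
    ultimately show "v j \<in> range ((*v) P_ideal)"
      using eigenvector_in_range_ideal[OF adm] eigenpair(1) by blast
  qed
  then show False using i by auto
qed

lemma eigenvalue_coarse: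
  assumes "\<tau> > tau0" and i: "i \<in> {1..CARD('c)}"
  shows "lam i \<noteq> 1"
proof
  assume l: "lam i = 1"
  \<comment> \<open>All eigenvalues from position \<open>i\<close> on are squeezed to 1, which gives at least \<open>n\<^sub>f + 1\<close> of them.\<close>
  have "card {i..CARD('f + 'c)} \<le> CARD('f)"
  proof (rule gen_eigensystem_card_le[OF es])
    show "{i..CARD('f + 'c)} \<subseteq> {1..CARD('f + 'c)}" using i by auto
    fix j assume "j \<in> {i..CARD('f + 'c)}"
    then have j: "j \<in> {1..CARD('f + 'c)}" "i \<le> j" using i by auto
    moreover have "i \<in> {1..CARD('f + 'c)}" using i by auto
    ultimately have "lam i \<le> lam j"
      using es unfolding gen_eigensystem_def by (blast intro: mono_onD)
    then have "lam j = 1" using l eigenpair(2)[OF j(1)] by linarith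
    then show "v j \<in> range ((*v) (vstack (mat 1) 0 :: real^'f^('f + 'c)))"
      using smoother_agrees_large[OF assms(1)] eigenpair(3)[OF j(1)] by blast
  qed
  then show False using i by (simp, linarith)
qed

lemma optimal_exact:
  assumes e: "bij_betw e (UNIV :: 'c set) {1..CARD('c)}"
    and inv: "invertible (lower_rows (optimal_interp e v))"
  shows "energy_opnorm A (two_grid_error A (M \<tau>) (classical_form (optimal_interp e v))) = 0"
proof -
  have "\<tau> \<noteq> 0" using adm by (simp add: admissible_def)
  have "M \<tau> *v v i = A *v v i" if "i \<in> {CARD('c) + 1..CARD('f + 'c)}" for i
    using that eigenpair(3)[of i] eigenvalue_fine[OF that] by auto
  then show ?thesis
    using two_grid_exact[OF spd_A smoother_inverse(2)[OF \<open>\<tau> \<noteq> 0\<close>] es e inv]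
    by (simp add: energy_opnorm_zero)
qed

text \<open>For such \<open>\<tau>\<close> the optimal interpolation is the ideal one times its own C-block, which the classical
form divides out.\<close>

lemma optimal_eq_ideal:
  assumes e: "bij_betw e (UNIV :: 'c set) {1..CARD('c)}"
    and inv: "invertible (lower_rows (optimal_interp e v))" and "\<tau> > tau0"
  shows "classical_form (optimal_interp e v) = P_ideal"
proof -
  let ?P = "optimal_interp e v"
  have "column j ?P \<in> range ((*v) P_ideal)" for j
  proof -
    have ej: "e j \<in> {1..CARD('c)}" using e by (auto simp: bij_betw_def)
    then have "v (e j) \<in> range ((*v) P_ideal)"
      using eigenvector_in_range_ideal[OF adm eigenpair(1)] eigenvalue_coarse[OF assms(3) ej] by auto
    then show ?thesis by (simp flip: matrix_vector_mult_basis add: optimal_interp_mult_axis)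
  qed
  then have "?P = P_ideal ** lower_rows ?P" by (rule eq_ideal_mult)
  then have "classical_form ?P = P_ideal ** (lower_rows ?P ** matrix_inv (lower_rows ?P))"
    unfolding classical_form_def by (metis matrix_mul_assoc)
  then show ?thesis by (simp add: matrix_inv_mult[OF inv])
qed

end

section \<open>The limiting case of pure F-relaxation\<close>

lemma smoother_inverse_limit:
  "((\<lambda>\<tau>. matrix_inv (M \<tau>)) \<longlongrightarrow> block_mat (matrix_inv Aff) 0 0 0) at_top"
proof -
  let ?G = "block_mat (matrix_inv Aff) 0 0 0 :: real^('f + 'c)^('f + 'c)"
  let ?H = "block_mat (D ** Acf ** matrix_inv Aff) (- D) (- (Acf ** matrix_inv Aff)) (mat 1)"
  have "((\<lambda>\<tau>. 1 / \<tau>) \<longlongrightarrow> (0 :: real)) at_top"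
    by (rule tendsto_divide_0[OF tendsto_const]) (simp add: filterlim_at_top_imp_at_infinity filterlim_ident)
  then have "((\<lambda>\<tau>. ?G + (1 / \<tau>) *\<^sub>R ?H) \<longlongrightarrow> ?G + 0 *\<^sub>R ?H) at_top"
    by (intro tendsto_intros)
  then have "((\<lambda>\<tau>. ?G + (1 / \<tau>) *\<^sub>R ?H) \<longlongrightarrow> ?G) at_top" by simp
  moreover have "\<forall>\<^sub>F \<tau> in at_top. ?G + (1 / \<tau>) *\<^sub>R ?H = matrix_inv (M \<tau>)"
    using eventually_gt_at_top[of 0] by eventually_elim (simp add: smoother_inverse)
  ultimately show ?thesis by (rule Lim_transform_eventually)
qed

lemma sym_smoother_inverse:
  assumes adm: "admissible A M \<tau>"
  shows "matrix_inv (sym_smoother A (M \<tau>)) =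
    matrix_inv (M \<tau>) + matrix_inv (M \<tau>) - matrix_inv (M \<tau>) ** A ** matrix_inv (M \<tau>)"
proof -
  let ?N = "M \<tau> + transpose (M \<tau>) - A"
  let ?R = "matrix_inv (M \<tau>)"
  have "\<tau> \<noteq> 0" and N: "invertible ?N"
    using adm spd_invertible by (auto simp: admissible_def)
  note R = matrix_inv_mult[OF smoother_inverse(2)[OF \<open>\<tau> \<noteq> 0\<close>]]
  have "sym_smoother A (M \<tau>) ** (?R ** ?N ** ?R)
      = M \<tau> ** (matrix_inv ?N ** ((M \<tau> ** ?R) ** ?N)) ** ?R"
    unfolding sym_smoother_def smoother_symmetric by (simp only: matrix_mul_assoc)
  also have "\<dots> = mat 1"
    by (simp add: R matrix_inv_mult[OF N])
  finally have "matrix_inv (sym_smoother A (M \<tau>)) = ?R ** ?N ** ?R"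
    by (rule matrix_inv_eqI)
  also have "\<dots> = ?R + ?R - ?R ** A ** ?R"
    unfolding smoother_symmetric
    by (simp only: matrix_mult_linear R matrix_mul_lid)
  finally show ?thesis .
qed

text \<open>With \<open>G\<close> the limit of \<open>M\<^sub>\<tau>\<^sup>-\<^sup>1\<close>, the inverse of the symmetrized smoother tends to
\<open>2 G - G A G\<close>, and \<open>G A G = G\<close> because \<open>A\<^sub>f\<^sub>f\<^sup>-\<^sup>1\<close> inverts the F-block of \<open>A\<close>.\<close>

lemma sym_smoother_limit:
  "((\<lambda>\<tau>. matrix_inv (sym_smoother A (M \<tau>)) ** A) \<longlongrightarrow> block_mat (mat 1) D 0 0) at_top"
proof -
  let ?G = "block_mat (matrix_inv Aff) 0 0 0 :: real^('f + 'c)^('f + 'c)"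
  let ?R = "\<lambda>\<tau>. matrix_inv (M \<tau>)"
  have lim: "((\<lambda>\<tau>. (?R \<tau> + ?R \<tau> - ?R \<tau> ** A ** ?R \<tau>) ** A) \<longlongrightarrow> (?G + ?G - ?G ** A ** ?G) ** A) at_top"
    by (intro tendsto_matrix_mult tendsto_diff tendsto_add tendsto_const smoother_inverse_limit)
  have val: "(?G + ?G - ?G ** A ** ?G) ** A = block_mat (mat 1) D 0 0"
    by (simp add: block_mat_mult block_mat_linear Aff_inv D_def)
  have ev: "\<forall>\<^sub>F \<tau> in at_top. (?R \<tau> + ?R \<tau> - ?R \<tau> ** A ** ?R \<tau>) ** A
      = matrix_inv (sym_smoother A (M \<tau>)) ** A"
    using eventually_gt_at_top[of tau0]
    by eventually_elim (simp add: sym_smoother_inverse admissible_large)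
  show ?thesis
    using Lim_transform_eventually[OF lim ev] unfolding val .
qed

lemma limit_kernel_iff: "block_mat (mat 1) D 0 0 *v x = 0 \<longleftrightarrow> x \<in> range ((*v) P_ideal)"
  by (simp add: vec_eq_parts parts_block_mat_mult parts_linear range_ideal_iff)

lemma inj_ideal: "inj ((*v) P_ideal)"
  by (metis c_part_ideal injI)

lemma ideal_indep_eigencolumns: "indep_eigencolumns (block_mat (mat 1) D 0 0) 0 P_ideal"
  unfolding indep_eigencolumns_def eigenvector_of_def
proof (intro conjI allI)
  show "column j P_ideal \<noteq> 0" for j
    by (metis c_part_ideal matrix_vector_mult_basis axis_eq_0_iff parts_linear(6) zero_neq_one)
  show "block_mat (mat 1) D 0 0 *v column j P_ideal = 0 *\<^sub>R column j P_ideal" for j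
    using limit_kernel_iff by (simp flip: matrix_vector_mult_basis)
  show inj: "inj (\<lambda>j. column j P_ideal)"
    by (rule injI) (metis c_part_ideal matrix_vector_mult_basis axis_eq_axis zero_neq_one)
  have "rank P_ideal = CARD('c)" using inj_ideal full_rank_injective by blast
  then have "CARD('c) = dim (columns P_ideal)" by (simp add: column_rank_def)
  moreover have "columns P_ideal = range (\<lambda>j. column j P_ideal)" by (auto simp: columns_def)
  ultimately show "independent (columns P_ideal)"
    using inj by (intro card_le_dim_spanning[of _ "span (columns P_ideal)"])
      (simp_all add: span_superset card_image)
qed

text \<open>\<open>P\<close> is the ideal interpolation times a square matrix; independence of the \<open>n\<^sub>c\<close> columns makes that
matrix injective, hence onto.\<close>

lemma range_indep_eigencolumns:
  fixes P :: "real^'c^('f + 'c)"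
  assumes P: "indep_eigencolumns (block_mat (mat 1) D 0 0) 0 P"
  shows "range ((*v) P) = range ((*v) P_ideal)"
proof -
  have "column j P \<in> range ((*v) P_ideal)" for j
    using P limit_kernel_iff[of "column j P"] by (simp add: indep_eigencolumns_def eigenvector_of_def)
  then have eq: "P = P_ideal ** lower_rows P" by (rule eq_ideal_mult)
  have "columns P = range (\<lambda>j. column j P)" by (auto simp: columns_def)
  then have "card (columns P) = CARD('c)"
    using P by (simp add: indep_eigencolumns_def card_image)
  then have "rank P = CARD('c)"
    using P by (simp add: column_rank_def indep_eigencolumns_def dim_eq_card_independent)
  then have "inj ((*v) P)" using full_rank_injective by blast
  then have "inj ((*v) (lower_rows P))"
    by (metis (no_types, lifting) eq injD injI matrix_vector_mul_assoc)
  then have "surj ((*v) (lower_rows P))"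
    by (simp add: linear_injective_imp_surjective)
  moreover have "range ((*v) P) = (*v) P_ideal ` range ((*v) (lower_rows P))"
    by (subst eq) (simp add: image_image matrix_vector_mul_assoc)
  ultimately show ?thesis by simp
qed

end

theorem mainTheorem5:
  fixes Aff :: "real^'f::finite^'f" and Afc :: "real^'c::finite^'f"
    and Acf :: "real^'f^'c" and Acc :: "real^'c^'c"
    and A :: "real^('f + 'c)^('f + 'c)"
    and M :: "real \<Rightarrow> real^('f + 'c)^('f + 'c)"
    and e :: "'c \<Rightarrow> nat"
  assumes A_def: "A = block_mat Aff Afc Acf Acc"
    and A_spd: "spd A"
    and M_def: "M = bf_smoother Aff Afc Acf"
    and e_enum: "bij_betw e UNIV {1..CARD('c)}"
  shows
    "(\<forall>\<tau> lam v. admissible A M \<tau> \<and> gen_eigensystem A (sym_smoother A (M \<tau>)) lam v \<longrightarrow>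
        (\<forall>i\<in>{CARD('c) + 1..CARD('f + 'c)}. lam i = 1) \<and>
        (invertible (lower_rows (optimal_interp e v)) \<longrightarrow>
          energy_opnorm A
            (two_grid_error A (M \<tau>) (classical_form (optimal_interp e v))) = 0))
     \<and>
     (\<forall>lam v. (\<forall>\<tau>. admissible A M \<tau> \<longrightarrow>
          gen_eigensystem A (sym_smoother A (M \<tau>)) (lam \<tau>) (v \<tau>) \<and>
          invertible (lower_rows (optimal_interp e (v \<tau>)))) \<longrightarrow>
        ((\<lambda>\<tau>. classical_form (optimal_interp e (v \<tau>))) \<longlongrightarrow> ideal_interp Aff Afc) at_top)
     \<and>
     ((\<lambda>\<tau>. matrix_inv (M \<tau>)) \<longlongrightarrow> block_mat (matrix_inv Aff) 0 0 0) at_top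
     \<and>
     ((\<lambda>\<tau>. matrix_inv (sym_smoother A (M \<tau>)) ** A)
        \<longlongrightarrow> block_mat (mat 1) (matrix_inv Aff ** Afc) 0 0) at_top
     \<and>
     (\<exists>P :: real^'c^('f + 'c).
        indep_eigencolumns (block_mat (mat 1) (matrix_inv Aff ** Afc) 0 0) 0 P)
     \<and>
     (\<forall>P :: real^'c^('f + 'c).
        indep_eigencolumns (block_mat (mat 1) (matrix_inv Aff ** Afc) 0 0) 0 P \<longrightarrow>
        range (\<lambda>x. P *v x) = range (\<lambda>x. ideal_interp Aff Afc *v x))"
proof -
  interpret spd_block Aff Afc Acf Acc
    using A_spd unfolding A_def by unfold_locales
  let ?A = "block_mat Aff Afc Acf Acc" and ?M = "bf_smoother Aff Afc Acf"
  show ?thesis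
    unfolding A_def M_def D_def[symmetric]
  proof (intro conjI allI impI ballI)
    fix \<tau> lam v i
    assume "admissible ?A ?M \<tau> \<and> gen_eigensystem ?A (sym_smoother ?A (?M \<tau>)) lam v"
      and "i \<in> {CARD('c) + 1..CARD('f + 'c)}"
    then show "lam i = 1" by (elim conjE) (rule eigenvalue_fine)
  next
    fix \<tau> lam v
    assume "admissible ?A ?M \<tau> \<and> gen_eigensystem ?A (sym_smoother ?A (?M \<tau>)) lam v"
      and "invertible (lower_rows (optimal_interp e v))"
    then show "energy_opnorm ?A
        (two_grid_error ?A (?M \<tau>) (classical_form (optimal_interp e v))) = 0"
      by (elim conjE) (rule optimal_exact[OF _ _ e_enum])
  next
    fix lam v
    assume *: "\<forall>\<tau>. admissible ?A ?M \<tau> \<longrightarrow>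
        gen_eigensystem ?A (sym_smoother ?A (?M \<tau>)) (lam \<tau>) (v \<tau>) \<and>
        invertible (lower_rows (optimal_interp e (v \<tau>)))"
    have "\<forall>\<^sub>F \<tau> in at_top. ideal_interp Aff Afc = classical_form (optimal_interp e (v \<tau>))"
      using eventually_gt_at_top[of tau0]
    proof eventually_elim
      case (elim \<tau>)
      then show ?case
        using * admissible_large[OF elim] optimal_eq_ideal[OF _ _ e_enum _ elim] by metis
    qed
    then show "((\<lambda>\<tau>. classical_form (optimal_interp e (v \<tau>))) \<longlongrightarrow> ideal_interp Aff Afc) at_top"
      by (rule Lim_transform_eventually[OF tendsto_const])
  next
    show "((\<lambda>\<tau>. matrix_inv (?M \<tau>)) \<longlongrightarrow> block_mat (matrix_inv Aff) 0 0 0) at_top"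
      by (rule smoother_inverse_limit)
  next
    show "((\<lambda>\<tau>. matrix_inv (sym_smoother ?A (?M \<tau>)) ** ?A) \<longlongrightarrow> block_mat (mat 1) D 0 0) at_top"
      by (rule sym_smoother_limit)
  next
    show "\<exists>P :: real^'c^('f + 'c). indep_eigencolumns (block_mat (mat 1) D 0 0) 0 P"
      using ideal_indep_eigencolumns by (rule exI)
  next
    fix P :: "real^'c^('f + 'c)"
    assume "indep_eigencolumns (block_mat (mat 1) D 0 0) 0 P"
    then show "range ((*v) P) = range ((*v) (ideal_interp Aff Afc))"
      by (rule range_indep_eigencolumns)
  qed
qed

end
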